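(* Let $P,Q$ be orthogonal projections in a Hilbert space $\mathcal{H}$. Then $P-Q$ is diagonalizable if and only if $P+Q$ is diagonalizable. In that case, for $\lambda\in\mathbb{R}$ with $0<|\lambda|<1$, $\lambda$ is an eigenvalue of $P-Q$ if and only if $1\pm(1-\lambda^2)^{1/2}$ are eigenvalues of $P+Q$, with the same multiplicity (that is, each of $1+(1-\lambda^2)^{1/2}$ and $1-(1-\lambda^2)^{1/2}$ has the same multiplicity for $P+Q$ as $\lambda$ has for $P-Q$).
   Context: A self-adjoint operator is diagonalizable if there is an orthonormal basis of the space consisting of its eigenvectors. *)

theory Defs
  imports "HOL-Analysis.Analysis"
begin

unbundle cardinal_syntax

text \<open>
  Complex Hilbert spaces. The inner product is linear in the first and conjugate-linear in the
  second argument. Positive definiteness of the inner product is contained in the last axiom: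
  norms are nonnegative and vanish only at 0, and \<open>sqrt\<close> of a negative real is negative.
\<close>

class complex_inner = real_normed_vector +
  fixes scaleC :: "complex \<Rightarrow> 'a \<Rightarrow> 'a"  (infixr \<open>*\<^sub>C\<close> 75)
    and cinner :: "'a \<Rightarrow> 'a \<Rightarrow> complex"
  assumes scaleC_add_right: "c *\<^sub>C (x + y) = c *\<^sub>C x + c *\<^sub>C y"
    and scaleC_add_left: "(c + d) *\<^sub>C x = c *\<^sub>C x + d *\<^sub>C x"
    and scaleC_scaleC: "c *\<^sub>C (d *\<^sub>C x) = (c * d) *\<^sub>C x"
    and scaleC_one: "1 *\<^sub>C x = x"
    and scaleR_scaleC: "r *\<^sub>R x = complex_of_real r *\<^sub>C x"
    and cinner_commute: "cinner x y = cnj (cinner y x)"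
    and cinner_add_left: "cinner (x + y) z = cinner x z + cinner y z"
    and cinner_scaleC_left: "cinner (c *\<^sub>C x) y = c * cinner x y"
    and norm_eq_sqrt_cinner: "norm x = sqrt (Re (cinner x x))"

class chilbert_space = complex_inner + banach

global_interpretation complex_vec: vector_space "scaleC :: complex \<Rightarrow> 'a \<Rightarrow> 'a::complex_inner"
  by standard (simp_all add: scaleC_add_right scaleC_add_left scaleC_scaleC scaleC_one)

definition bounded_clinear :: "('a::complex_inner \<Rightarrow> 'a) \<Rightarrow> bool" where
  "bounded_clinear T \<longleftrightarrow> bounded_linear T \<and> (\<forall>c x. T (c *\<^sub>C x) = c *\<^sub>C T x)"

definition selfadjoint :: "('a::complex_inner \<Rightarrow> 'a) \<Rightarrow> bool" where
  "selfadjoint T \<longleftrightarrow> bounded_clinear T \<and> (\<forall>x y. cinner (T x) y = cinner x (T y))"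

definition orthogonal_projection :: "('a::complex_inner \<Rightarrow> 'a) \<Rightarrow> bool" where
  "orthogonal_projection P \<longleftrightarrow> selfadjoint P \<and> P \<circ> P = P"

definition orthonormal_set :: "'a::complex_inner set \<Rightarrow> bool" where
  "orthonormal_set E \<longleftrightarrow> (\<forall>x\<in>E. \<forall>y\<in>E. cinner x y = (if x = y then 1 else 0))"

definition orthonormal_basis_of :: "'a::complex_inner set \<Rightarrow> 'a set \<Rightarrow> bool" where
  "orthonormal_basis_of M E \<longleftrightarrow> orthonormal_set E \<and> closure (complex_vec.span E) = M"

definition ceigenspace :: "('a::complex_inner \<Rightarrow> 'a) \<Rightarrow> complex \<Rightarrow> 'a set" where
  "ceigenspace T c = {x. T x = c *\<^sub>C x}"

definition is_ceigenvector :: "('a::complex_inner \<Rightarrow> 'a) \<Rightarrow> complex \<Rightarrow> 'a \<Rightarrow> bool" where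
  "is_ceigenvector T c x \<longleftrightarrow> x \<noteq> 0 \<and> x \<in> ceigenspace T c"

definition is_ceigenvalue :: "('a::complex_inner \<Rightarrow> 'a) \<Rightarrow> complex \<Rightarrow> bool" where
  "is_ceigenvalue T c \<longleftrightarrow> (\<exists>x. is_ceigenvector T c x)"

definition diagonalizable_op :: "('a::complex_inner \<Rightarrow> 'a) \<Rightarrow> bool" where
  "diagonalizable_op T \<longleftrightarrow>
     (\<exists>E. orthonormal_basis_of UNIV E \<and> (\<forall>e\<in>E. \<exists>c. is_ceigenvector T c e))"

text \<open>
  The Hilbert dimension of a closed subspace is the cardinality of any of its orthonormal bases,
  possibly infinite and possibly uncountable. It is therefore represented by a cardinal
  in the sense of \<open>card_of\<close>, and dimensions are to be compared with \<open>=o\<close> rather than \<open>=\<close>.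
\<close>

definition hilbert_dim :: "'a::chilbert_space set \<Rightarrow> 'a rel" where
  "hilbert_dim M = |SOME E. orthonormal_basis_of M E|"

definition ceigen_mult :: "('a::chilbert_space \<Rightarrow> 'a) \<Rightarrow> complex \<Rightarrow> 'a rel" where
  "ceigen_mult T c = hilbert_dim (ceigenspace T c)"

end

theory Submission
  imports Defs "HOL-Library.Countable_Set_Type"
begin

text \<open>
  Put \<open>A = P - Q\<close> and \<open>B = P + Q - 1\<close>. Then \<open>A\<^sup>2 + B\<^sup>2 = 1\<close> and \<open>A B = - B A\<close>, relations that are
  symmetric in \<open>A\<close> and \<open>B\<close>. If \<open>A x = c x\<close> and \<open>m\<^sup>2 = 1 - c\<^sup>2\<close>, then \<open>B x + m x\<close> and \<open>B x - m x\<close> are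
  eigenvectors of \<open>B\<close> (or zero) for \<open>m\<close> and \<open>- m\<close>, and they span \<open>x\<close> unless \<open>m = 0\<close>, in which case
  \<open>B x = 0\<close>. So the eigenvectors of \<open>B\<close> are total as soon as those of \<open>A\<close> are. For real \<open>l, m \<noteq> 0\<close> with
  \<open>l\<^sup>2 + m\<^sup>2 = 1\<close>, the operator \<open>(B + m) / (\<surd>2 m)\<close> maps \<open>ker (A - l)\<close> isometrically into \<open>ker (B - m)\<close>,
  which bounds one Hilbert dimension by the other; exchanging \<open>A\<close> and \<open>B\<close> gives equality.
\<close>

section \<open>Inner product algebra and the Cauchy-Schwarz inequality\<close>

lemma cinner_add_right: "cinner x (y + z) = cinner x y + cinner x (z::'a::complex_inner)"
  by (metis cinner_add_left cinner_commute complex_cnj_add)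

lemma cinner_scaleC_right: "cinner x (c *\<^sub>C y) = cnj c * cinner x (y::'a::complex_inner)"
  by (metis cinner_scaleC_left cinner_commute complex_cnj_mult)

lemma cinner_zero_left [simp]: "cinner 0 (y::'a::complex_inner) = 0"
  by (metis add_cancel_right_right add.right_neutral cinner_add_left)

lemma cinner_zero_right [simp]: "cinner (x::'a::complex_inner) 0 = 0"
  by (metis add_cancel_right_right add.right_neutral cinner_add_right)

lemma cinner_minus_left: "cinner (- x) y = - cinner x (y::'a::complex_inner)"
  by (metis add.right_inverse cinner_add_left cinner_zero_left minus_unique)

lemma cinner_minus_right: "cinner x (- y) = - cinner x (y::'a::complex_inner)"
  by (metis add.right_inverse cinner_add_right cinner_zero_right minus_unique)

lemma cinner_diff_left: "cinner (x - y) z = cinner x z - cinner y (z::'a::complex_inner)"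
  by (metis cinner_add_left cinner_minus_left diff_conv_add_uminus)

lemma cinner_diff_right: "cinner x (y - z) = cinner x y - cinner x (z::'a::complex_inner)"
  by (metis cinner_add_right cinner_minus_right diff_conv_add_uminus)

lemma cinner_sum_left: "cinner (\<Sum>i\<in>I. f i) y = (\<Sum>i\<in>I. cinner (f i) (y::'a::complex_inner))"
  by (induction I rule: infinite_finite_induct) (auto simp: cinner_add_left)

text \<open>Conjugate symmetry makes \<open>cinner x x\<close> real. Since the real
  \<open>sqrt\<close> of a negative number is negative, nonnegativity of the norm excludes a
  negative value.\<close>

lemma cinner_self: "cinner x x = complex_of_real ((norm (x::'a::complex_inner))\<^sup>2)"
proof (rule complex_eqI)
  show "Im (cinner x x) = Im (complex_of_real ((norm x)\<^sup>2))"
    using arg_cong[OF cinner_commute[of x x], of Im] by simp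
  have "Re (cinner x x) \<ge> 0"
    using norm_ge_zero[of x] unfolding norm_eq_sqrt_cinner[of x] by simp
  then show "Re (cinner x x) = Re (complex_of_real ((norm x)\<^sup>2))"
    by (simp add: norm_eq_sqrt_cinner)
qed

lemma norm_sq: "(norm (x::'a::complex_inner))\<^sup>2 = Re (cinner x x)"
  by (simp add: cinner_self)

lemma cinner_self_eq_0_iff [simp]: "cinner x x = 0 \<longleftrightarrow> x = (0::'a::complex_inner)"
  by (simp add: cinner_self)

lemma norm_scaleC: "norm (c *\<^sub>C (x::'a::complex_inner)) = cmod c * norm x"
proof -
  have "(norm (c *\<^sub>C x))\<^sup>2 = Re ((c * cnj c) * cinner x x)"
    unfolding norm_sq by (simp add: cinner_scaleC_left cinner_scaleC_right mult_ac)
  also have "\<dots> = (cmod c * norm x)\<^sup>2"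
    by (simp add: cinner_self complex_mult_cnj cmod_def power_mult_distrib)
  finally show ?thesis
    by (simp add: power2_eq_iff_nonneg)
qed

lemma norm_sq_diff:
  "(norm (x - y))\<^sup>2 = (norm x)\<^sup>2 - 2 * Re (cinner x y) + (norm (y::'a::complex_inner))\<^sup>2"
proof -
  have "Re (cinner y x) = Re (cinner x y)"
    using arg_cong[OF cinner_commute[of x y], of Re] by simp
  then show ?thesis
    unfolding norm_sq by (simp add: cinner_diff_left cinner_diff_right)
qed

lemma norm_sq_add:
  "(norm (x + y))\<^sup>2 = (norm x)\<^sup>2 + 2 * Re (cinner x y) + (norm (y::'a::complex_inner))\<^sup>2"
  using norm_sq_diff[of x "- y"] by (simp add: cinner_minus_right)

text \<open>Pythagoras for the component of \<open>x\<close> along a unit vector. Cauchy-Schwarz,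
  the projection theorem and Bessel's inequality all rest on this identity.\<close>

lemma norm_sq_diff_component:
  fixes x y :: "'a::complex_inner"
  assumes "norm y = 1"
  shows "(norm (x - cinner x y *\<^sub>C y))\<^sup>2 = (norm x)\<^sup>2 - (cmod (cinner x y))\<^sup>2"
proof -
  have "cinner x (cinner x y *\<^sub>C y) = complex_of_real ((cmod (cinner x y))\<^sup>2)"
    by (simp only: cinner_scaleC_right complex_norm_square mult.commute)
  then show ?thesis
    unfolding norm_sq_diff using assms by (simp add: norm_scaleC)
qed

text \<open>For the normalized vector \<open>u\<close> in place of \<open>y\<close>, the claim is
  that the squared norm in \<open>norm_sq_diff_component\<close> is nonnegative.\<close>

lemma cauchy_schwarz: "cmod (cinner x y) \<le> norm x * norm (y::'a::complex_inner)"
proof (cases "y = 0")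
  case False
  define u where "u = complex_of_real (1 / norm y) *\<^sub>C y"
  have u: "norm u = 1"
    using False by (simp add: u_def norm_scaleC norm_divide)
  have "(cmod (cinner x u))\<^sup>2 \<le> (norm x)\<^sup>2"
    using norm_sq_diff_component[OF u, of x] by (metis diff_ge_0_iff_ge zero_le_power2)
  then have "cmod (cinner x u) \<le> norm x"
    by (rule power2_le_imp_le) simp
  then show ?thesis
    using False by (simp add: u_def cinner_scaleC_right norm_mult norm_divide field_simps)
qed simp

lemma bounded_linear_cinner_left: "bounded_linear (\<lambda>x. cinner x (y::'a::complex_inner))"
  by (rule bounded_linear_intro[where K = "norm y"])
    (simp_all add: cinner_add_left scaleR_scaleC cinner_scaleC_left cauchy_schwarz scaleR_conv_of_real)

lemma bounded_linear_scaleC: "bounded_linear (\<lambda>x. c *\<^sub>C (x::'a::complex_inner))"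
  by (rule bounded_linear_intro[where K = "cmod c"])
    (simp_all add: scaleC_add_right scaleR_scaleC scaleC_scaleC norm_scaleC mult.commute)

section \<open>Closed spans and orthogonality\<close>

lemma closed_cinner_zero: "closed {x. cinner x (y::'a::complex_inner) = 0}"
  by (intro closed_Collect_eq continuous_intros linear_continuous_on bounded_linear_cinner_left)

lemma subspace_cinner_zero: "complex_vec.subspace {x. cinner x (y::'a::complex_inner) = 0}"
  by (simp add: complex_vec.subspace_def cinner_add_left cinner_scaleC_left)

lemma closure_span_minimal:
  assumes "S \<subseteq> M" "complex_vec.subspace M" "closed M"
  shows "closure (complex_vec.span S) \<subseteq> (M::'a::complex_inner set)"
  by (intro closure_minimal complex_vec.span_minimal assms)

lemma subset_closure_span: "S \<subseteq> closure (complex_vec.span (S::'a::complex_inner set))"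
  by (meson closure_subset complex_vec.span_superset order_trans)

text \<open>The vectors orthogonal to \<open>y\<close> form a closed subspace, so it contains the
  closed span of \<open>S\<close> once it contains \<open>S\<close>.\<close>

lemma orthogonal_closure_span:
  fixes x y :: "'a::complex_inner"
  assumes "x \<in> closure (complex_vec.span S)" "\<And>s. s \<in> S \<Longrightarrow> cinner s y = 0"
  shows "cinner x y = 0"
  using closure_span_minimal[OF _ subspace_cinner_zero closed_cinner_zero, of S y] assms by auto

lemma subspace_closure:
  assumes "complex_vec.subspace (M::'a::complex_inner set)"
  shows "complex_vec.subspace (closure M)"
  unfolding complex_vec.subspace_def
proof (intro conjI ballI allI)
  show "0 \<in> closure M"
    using assms closure_subset complex_vec.subspace_0 by blast
  show "x + y \<in> closure M" if x: "x \<in> closure M" and y: "y \<in> closure M" for x y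
  proof -
    obtain f where "\<forall>n. f n \<in> M" "f \<longlonglongrightarrow> x"
      using x unfolding closure_sequential by blast
    moreover obtain g where "\<forall>n. g n \<in> M" "g \<longlonglongrightarrow> y"
      using y unfolding closure_sequential by blast
    ultimately show ?thesis
      unfolding closure_sequential
      by (intro exI[of _ "\<lambda>n. f n + g n"]) (auto intro: tendsto_add complex_vec.subspace_add[OF assms])
  qed
  show "c *\<^sub>C x \<in> closure M" if x: "x \<in> closure M" for c x
  proof -
    obtain f where "\<forall>n. f n \<in> M" "f \<longlonglongrightarrow> x"
      using x unfolding closure_sequential by blast
    then show ?thesis
      unfolding closure_sequential
      by (intro exI[of _ "\<lambda>n. c *\<^sub>C f n"])
        (auto intro: bounded_linear.tendsto[OF bounded_linear_scaleC] complex_vec.subspace_scale[OF assms])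
  qed
qed

section \<open>Orthogonal projection onto a closed subspace\<close>

text \<open>Here \<open>z\<close> plays the role of the difference between a point and its nearest
  point in \<open>M\<close>. Removing the component of \<open>z\<close> along a unit vector of
  \<open>M\<close> would shorten \<open>z\<close> unless that component is zero.\<close>

lemma nearest_point_orthogonal:
  fixes z y :: "'a::complex_inner"
  assumes M: "complex_vec.subspace M" and y: "y \<in> M"
    and le: "\<And>m. m \<in> M \<Longrightarrow> norm z \<le> norm (z - m)"
  shows "cinner z y = 0"
proof (cases "y = 0")
  case False
  define u where "u = complex_of_real (1 / norm y) *\<^sub>C y"
  have u: "norm u = 1"
    using False by (simp add: u_def norm_scaleC norm_divide)
  have "cinner z u *\<^sub>C u \<in> M"
    unfolding u_def by (intro complex_vec.subspace_scale M y)
  then have "(norm z)\<^sup>2 \<le> (norm (z - cinner z u *\<^sub>C u))\<^sup>2"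
    by (intro power_mono le) auto
  then have "cinner z u = 0"
    unfolding norm_sq_diff_component[OF u] by simp
  then show ?thesis
    using False by (simp add: u_def cinner_scaleC_right)
qed simp

text \<open>A minimizing sequence for the distance from \<open>x\<close> to \<open>M\<close> is
  Cauchy by the parallelogram law; completeness and closedness of \<open>M\<close> make its limit a
  nearest point.\<close>

theorem projection_onto_closed_subspace:
  fixes M :: "'a::chilbert_space set"
  assumes M: "complex_vec.subspace M" "closed M"
  obtains m where "m \<in> M" "\<And>y. y \<in> M \<Longrightarrow> cinner (x - m) y = 0"
proof -
  have ne: "M \<noteq> {}"
    using complex_vec.subspace_0[OF M(1)] by auto
  define d where "d = infdist x M"
  have d0: "d \<ge> 0" by (simp add: d_def infdist_nonneg)
  have d: "d \<le> norm (x - m)" if "m \<in> M" for m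
    using infdist_le[OF that, of x] by (simp add: d_def dist_norm)
  have "bdd_below (dist x ` M)"
    by (rule bdd_belowI2[of _ 0]) simp
  then have "\<exists>m\<in>M. norm (x - m) < d + inverse (Suc n)" for n
    unfolding d_def infdist_notempty[OF ne]
    using cINF_less_iff[OF ne, of "dist x" "(INF a\<in>M. dist x a) + inverse (Suc n)"]
    by (auto simp: dist_norm)
  then obtain f where f: "\<And>n. f n \<in> M" "\<And>n. norm (x - f n) < d + inverse (Suc n)"
    by metis
  have lim: "(\<lambda>n. norm (x - f n)) \<longlonglongrightarrow> d"
  proof (rule tendsto_sandwich[of "\<lambda>_. d"])
    show "(\<lambda>n. d + inverse (Suc n)) \<longlonglongrightarrow> d"
      using tendsto_add[OF tendsto_const[of d] LIMSEQ_inverse_real_of_nat] by simp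
  qed (use d f in \<open>auto intro!: always_eventually less_imp_le simp del: of_nat_Suc\<close>)
  have parallelogram:
    "(norm (f i - f j))\<^sup>2 \<le> 2 * (norm (x - f i))\<^sup>2 + 2 * (norm (x - f j))\<^sup>2 - 4 * d\<^sup>2" for i j
  proof -
    \<comment> \<open>The midpoint \<open>h\<close> lies in \<open>M\<close>, hence at distance at
      least \<open>d\<close> from \<open>x\<close>. This bounds the sum term of the parallelogram
      law from below and so the difference term from above.\<close>
    define h where "h = (1/2) *\<^sub>R (f i + f j)"
    have "h \<in> M"
      unfolding h_def scaleR_scaleC by (intro complex_vec.subspace_scale complex_vec.subspace_add M f)
    then have "d\<^sup>2 \<le> (norm (x - h))\<^sup>2"
      by (intro power_mono d d0)
    moreover have "(x - f i) + (x - f j) = 2 *\<^sub>R (x - h)"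
      by (simp add: h_def algebra_simps scaleR_2)
    then have "(norm ((x - f i) + (x - f j)))\<^sup>2 = 4 * (norm (x - h))\<^sup>2"
      by (simp add: power_mult_distrib)
    moreover have "(x - f j) - (x - f i) = f i - f j" by simp
    ultimately show ?thesis
      using norm_sq_add[of "x - f j" "x - f i"] norm_sq_diff[of "x - f j" "x - f i"]
      by (simp add: add.commute)
  qed
  have "Cauchy f"
  proof (rule metric_CauchyI)
    fix e :: real assume e: "e > 0"
    have "(\<lambda>n. (norm (x - f n))\<^sup>2) \<longlonglongrightarrow> d\<^sup>2"
      by (intro tendsto_power lim)
    \<comment> \<open>The slack \<open>e\<^sup>2 / 4\<close> enters \<open>parallelogram\<close>
      twice with factor 2, which leaves exactly \<open>e\<^sup>2\<close> after
      \<open>4 * d\<^sup>2\<close> cancels.\<close>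
    then obtain N where N: "\<And>n. n \<ge> N \<Longrightarrow> (norm (x - f n))\<^sup>2 < d\<^sup>2 + e\<^sup>2 / 4"
      using order_tendstoD(2)[of _ "d\<^sup>2" sequentially "d\<^sup>2 + e\<^sup>2 / 4"] e
      by (auto simp: eventually_sequentially)
    have "dist (f i) (f j) < e" if "i \<ge> N" "j \<ge> N" for i j
    proof -
      have "(norm (f i - f j))\<^sup>2 < e\<^sup>2"
        using parallelogram[of i j] N[OF that(1)] N[OF that(2)] by simp
      then show ?thesis
        using e by (simp add: dist_norm power2_less_imp_less)
    qed
    then show "\<exists>N. \<forall>i\<ge>N. \<forall>j\<ge>N. dist (f i) (f j) < e" by blast
  qed
  then obtain m where m: "f \<longlonglongrightarrow> m"
    using Cauchy_convergent convergent_def by blast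
  have mM: "m \<in> M"
    using closed_sequentially[OF M(2) _ m] f by blast
  have "norm (x - m) = d"
    using LIMSEQ_unique[OF tendsto_norm[OF tendsto_diff[OF tendsto_const m]] lim] .
  then have "norm (x - m) \<le> norm (x - m - y)" if "y \<in> M" for y
    using d[OF complex_vec.subspace_add[OF M(1) mM that]] by (simp add: algebra_simps)
  then show thesis
    using that mM nearest_point_orthogonal[OF M(1)] by blast
qed

section \<open>Orthonormal sets and existence of orthonormal bases\<close>

lemma orthonormal_setD:
  assumes "orthonormal_set E" "x \<in> E"
  shows "norm x = 1" "y \<in> E \<Longrightarrow> x \<noteq> y \<Longrightarrow> cinner x y = 0" "cinner x x = 1"
  using assms by (auto simp: orthonormal_set_def norm_eq_sqrt_cinner)

lemma orthonormal_set_insert: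
  fixes z :: "'a::complex_inner"
  assumes E: "orthonormal_set E" and z: "norm z = 1" "\<And>e. e \<in> E \<Longrightarrow> cinner z e = 0"
  shows "orthonormal_set (insert z E)"
proof -
  have "cinner e z = 0" if "e \<in> E" for e
    using z(2)[OF that] cinner_commute[of e z] by simp
  moreover have "z \<notin> E"
    using z(2)[of z] z(1) by (auto simp: cinner_self)
  ultimately show ?thesis
    using assms unfolding orthonormal_set_def by (auto simp: cinner_self)
qed

lemma orthonormal_set_subset: "orthonormal_set E \<Longrightarrow> F \<subseteq> E \<Longrightarrow> orthonormal_set F"
  unfolding orthonormal_set_def by blast

text \<open>Zorn's lemma yields a maximal orthonormal subset of \<open>M\<close>. If its closed span
  missed a point of \<open>M\<close>, the normalized difference between that point and its
  projection could be added.\<close>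

theorem orthonormal_basis_exists:
  fixes M :: "'a::chilbert_space set"
  assumes M: "complex_vec.subspace M" "closed M"
  shows "\<exists>E. orthonormal_basis_of M E"
proof -
  define \<A> where "\<A> = {E. E \<subseteq> M \<and> orthonormal_set E}"
  have "\<Union>C \<in> \<A>" if "subset.chain \<A> C" for C
  proof -
    \<comment> \<open>Two vectors from members of a chain lie together in the larger member, which
      is orthonormal.\<close>
    have "cinner x y = (if x = y then 1 else 0)" if "X \<in> C" "x \<in> X" "Y \<in> C" "y \<in> Y" for x y X Y
    proof -
      have "X \<subseteq> Y \<or> Y \<subseteq> X" "orthonormal_set X" "orthonormal_set Y"
        using that \<open>subset.chain \<A> C\<close> by (auto simp: subset_chain_def \<A>_def)
      then show ?thesis
        using that unfolding orthonormal_set_def by (metis subsetD)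
    qed
    then show ?thesis
      using that by (auto simp: \<A>_def subset_chain_def orthonormal_set_def)
  qed
  then obtain E where "E \<in> \<A>" and maximal: "\<And>X. X \<in> \<A> \<Longrightarrow> E \<subseteq> X \<Longrightarrow> X = E"
    using subset_Zorn'[of \<A>] by metis
  then have E: "E \<subseteq> M" "orthonormal_set E"
    by (auto simp: \<A>_def)
  have "M \<subseteq> closure (complex_vec.span E)"
  proof
    fix x assume x: "x \<in> M"
    obtain m where m: "m \<in> closure (complex_vec.span E)"
      and orth: "\<And>y. y \<in> closure (complex_vec.span E) \<Longrightarrow> cinner (x - m) y = 0"
      using projection_onto_closed_subspace[OF subspace_closure[OF complex_vec.subspace_span]
          closed_closure, where x = x] by blast
    have "m \<in> M"
      using m closure_span_minimal[OF E(1) M] by auto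
    have "x - m = 0"
    proof (rule ccontr)
      assume ne: "x - m \<noteq> 0"
      define z where "z = complex_of_real (1 / norm (x - m)) *\<^sub>C (x - m)"
      have z: "norm z = 1"
        using ne by (simp add: z_def norm_scaleC norm_divide)
      have "z \<in> M"
        unfolding z_def by (intro complex_vec.subspace_scale complex_vec.subspace_diff M x \<open>m \<in> M\<close>)
      moreover have orth_z: "cinner z e = 0" if "e \<in> E" for e
        unfolding z_def cinner_scaleC_left using orth that subset_closure_span by fastforce
      ultimately have "insert z E \<in> \<A>"
        using E z orthonormal_set_insert by (auto simp: \<A>_def)
      then have "z \<in> E"
        using maximal by blast
      then show False
        using orth_z[of z] z by (simp add: cinner_self)
    qed
    then show "x \<in> closure (complex_vec.span E)"
      using m by simp
  qed
  then show ?thesis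
    using closure_span_minimal[OF E(1) M] E unfolding orthonormal_basis_of_def by blast
qed

section \<open>Bessel's inequality and cardinalities of orthonormal sets\<close>

lemma orthonormal_sum_coeff:
  fixes E :: "'a::complex_inner set"
  assumes "orthonormal_set E" "finite F" "F \<subseteq> E" "e \<in> F"
  shows "cinner (\<Sum>f\<in>F. u f *\<^sub>C f) e = u e"
proof -
  have "cinner (\<Sum>f\<in>F. u f *\<^sub>C f) e = (\<Sum>f\<in>F. if f = e then u f else 0)"
    unfolding cinner_sum_left cinner_scaleC_left
    using orthonormal_set_subset[OF assms(1,3)] assms(4)
    by (intro sum.cong) (auto simp: orthonormal_set_def)
  then show ?thesis
    using assms by simp
qed

lemma orthonormal_independent:
  assumes "orthonormal_set (E::'a::complex_inner set)"
  shows "complex_vec.independent E"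
  unfolding complex_vec.independent_explicit_finite_subsets
  using orthonormal_sum_coeff[OF assms] by (metis cinner_zero_left)

text \<open>The gap between the two sides is the squared norm of what remains of \<open>x\<close>
  after all components along \<open>E\<close> are removed. Induction removes one component at a
  time.\<close>

lemma bessel:
  fixes x :: "'a::complex_inner"
  assumes "orthonormal_set E" "finite E"
  shows "(\<Sum>e\<in>E. (cmod (cinner x e))\<^sup>2) \<le> (norm x)\<^sup>2"
proof -
  have "(norm (x - (\<Sum>e\<in>E. cinner x e *\<^sub>C e)))\<^sup>2 = (norm x)\<^sup>2 - (\<Sum>e\<in>E. (cmod (cinner x e))\<^sup>2)"
    using assms(2,1)
  proof (induction E rule: finite_induct)
    case (insert a E)
    define s where "s = (\<Sum>e\<in>E. cinner x e *\<^sub>C e)"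
    have a: "norm a = 1" and E: "orthonormal_set E"
      using orthonormal_setD(1)[OF insert.prems] orthonormal_set_subset[OF insert.prems] by auto
    have "cinner s a = 0"
      unfolding s_def cinner_sum_left cinner_scaleC_left
      using insert by (intro sum.neutral) (auto simp: orthonormal_set_def)
    then have "cinner (x - s) a = cinner x a"
      by (simp add: cinner_diff_left)
    then show ?case
      using norm_sq_diff_component[OF a, of "x - s"] insert.IH[OF E] insert.hyps
      by (simp add: s_def algebra_simps)
  qed simp
  then show ?thesis
    using zero_le_power2[of "norm (x - (\<Sum>e\<in>E. cinner x e *\<^sub>C e))"] by linarith
qed

text \<open>Bessel bounds all finite sums of the squared coefficients, so they are summable, and a
  summable real family has countable support.\<close>

lemma countable_nonzero_coeffs:
  fixes x :: "'a::complex_inner"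
  assumes E: "orthonormal_set E"
  shows "countable {e \<in> E. cinner x e \<noteq> 0}"
proof -
  have "bdd_above (sum (\<lambda>e. (cmod (cinner x e))\<^sup>2) ` {F. F \<subseteq> E \<and> finite F})"
  proof (rule bdd_aboveI2)
    fix F assume "F \<in> {F. F \<subseteq> E \<and> finite F}"
    then show "(\<Sum>e\<in>F. (cmod (cinner x e))\<^sup>2) \<le> (norm x)\<^sup>2"
      using E by (intro bessel) (auto intro: orthonormal_set_subset)
  qed
  then have "(\<lambda>e. (cmod (cinner x e))\<^sup>2) summable_on E"
    by (intro nonneg_bdd_above_summable_on) auto
  then have "countable {e \<in> E. (cmod (cinner x e))\<^sup>2 \<noteq> 0}"
    by (rule summable_countable_real)
  then show ?thesis by simp
qed

text \<open>Subtracting from \<open>x\<close> its Fourier sum \<open>s\<close> leaves a vector in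
  the closed span that is orthogonal to \<open>E\<close>, hence to itself.\<close>

lemma closure_span_finite:
  fixes E :: "'a::complex_inner set"
  assumes "orthonormal_set E" "finite E"
  shows "closure (complex_vec.span E) = complex_vec.span E"
proof (rule equalityI[OF subsetI closure_subset])
  fix x assume x: "x \<in> closure (complex_vec.span E)"
  define s where "s = (\<Sum>e\<in>E. cinner x e *\<^sub>C e)"
  have s: "s \<in> complex_vec.span E"
    unfolding s_def by (intro complex_vec.span_sum complex_vec.span_scale complex_vec.span_base)
  have "cinner e (x - s) = 0" if "e \<in> E" for e
  proof -
    have "cinner (x - s) e = 0"
      using orthonormal_sum_coeff[OF assms order_refl that] by (simp add: s_def cinner_diff_left)
    then show ?thesis
      using cinner_commute[of e "x - s"] by simp
  qed
  moreover have "x - s \<in> closure (complex_vec.span E)"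
    using x s closure_subset
    by (intro complex_vec.subspace_diff subspace_closure complex_vec.subspace_span) auto
  ultimately have "cinner (x - s) (x - s) = 0"
    by (rule orthogonal_closure_span[rotated])
  then show "x \<in> complex_vec.span E"
    using s by simp
qed

text \<open>For finite \<open>E\<close> this is the bound on independent sets in a span. For
  infinite \<open>E\<close>, each vector of \<open>F\<close> has a nonzero coefficient at some
  \<open>e\<close> in \<open>E\<close>, and each \<open>e\<close> serves only countably many vectors
  of \<open>F\<close>.\<close>

theorem card_of_orthonormal_le:
  fixes E F :: "'a::complex_inner set"
  assumes E: "orthonormal_set E" and F: "orthonormal_set F"
    and sub: "F \<subseteq> closure (complex_vec.span E)"
  shows "|F| \<le>o |E|"
proof (cases "finite E")
  case True
  then have "finite F \<and> card F \<le> card E"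
    using complex_vec.independent_span_bound[OF True orthonormal_independent[OF F]] sub
      closure_span_finite[OF E True] by simp
  then obtain f where "f ` F \<subseteq> E" "inj_on f F"
    using True card_le_inj by blast
  then show ?thesis
    using card_of_ordLeq by blast
next
  case False
  have "F \<subseteq> (\<Union>e\<in>E. {f \<in> F. cinner e f \<noteq> 0})"
  proof
    fix f assume f: "f \<in> F"
    then have "cinner f f \<noteq> 0"
      using orthonormal_setD(3)[OF F] by simp
    \<comment> \<open>Otherwise \<open>f\<close>, lying in the closed span of \<open>E\<close>,
      would be orthogonal to itself.\<close>
    then have "\<exists>e\<in>E. cinner e f \<noteq> 0"
      using orthogonal_closure_span[of f E f] f sub by blast
    then show "f \<in> (\<Union>e\<in>E. {f \<in> F. cinner e f \<noteq> 0})"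
      using f by blast
  qed
  then have "|F| \<le>o |\<Union>e\<in>E. {f \<in> F. cinner e f \<noteq> 0}|"
    by (rule card_of_mono1)
  also have "|\<Union>e\<in>E. {f \<in> F. cinner e f \<noteq> 0}| \<le>o |E|"
  proof (rule card_of_UNION_ordLeq_infinite[OF False card_of_refl[THEN ordIso_imp_ordLeq]], rule ballI)
    fix e
    have "|{f \<in> F. cinner e f \<noteq> 0}| \<le>o |UNIV::nat set|"
      using countable_nonzero_coeffs[OF F] by (simp add: countable_card_of_nat)
    also have "|UNIV::nat set| \<le>o |E|"
      using False by (simp add: infinite_iff_card_of_nat)
    finally show "|{f \<in> F. cinner e f \<noteq> 0}| \<le>o |E|" .
  qed
  finally show ?thesis .
qed

section \<open>Self-adjoint operators and their eigenspaces\<close>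

lemma selfadjointD:
  assumes "selfadjoint (T::'a::complex_inner \<Rightarrow> 'a)"
  shows "bounded_linear T" "T (c *\<^sub>C x) = c *\<^sub>C T x" "cinner (T x) y = cinner x (T y)"
    "T (x + y) = T x + T y" "T (x - y) = T x - T y" "T 0 = 0"
proof -
  show "bounded_linear T"
    using assms by (simp add: selfadjoint_def bounded_clinear_def)
  then interpret bounded_linear T .
  show "T (x + y) = T x + T y" "T (x - y) = T x - T y" "T 0 = 0"
    by (rule add diff zero)+
qed (use assms in \<open>simp_all add: selfadjoint_def bounded_clinear_def\<close>)

lemma selfadjointI:
  assumes "bounded_linear T" "\<And>c x. T (c *\<^sub>C x) = c *\<^sub>C T x"
    "\<And>x y. cinner (T x) y = cinner x (T (y::'a::complex_inner))"
  shows "selfadjoint T"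
  using assms by (simp add: selfadjoint_def bounded_clinear_def)

lemma selfadjoint_add:
  assumes "selfadjoint (S::'a::complex_inner \<Rightarrow> 'a)" "selfadjoint T"
  shows "selfadjoint (\<lambda>x. S x + T x)"
  by (rule selfadjointI[OF bounded_linear_add[OF assms[THEN selfadjointD(1)]]])
    (simp_all add: assms[THEN selfadjointD(2)] assms[THEN selfadjointD(3)] scaleC_add_right
      cinner_add_left cinner_add_right)

lemma selfadjoint_diff:
  assumes "selfadjoint (S::'a::complex_inner \<Rightarrow> 'a)" "selfadjoint T"
  shows "selfadjoint (\<lambda>x. S x - T x)"
  by (rule selfadjointI[OF bounded_linear_sub[OF assms[THEN selfadjointD(1)]]])
    (simp_all add: assms[THEN selfadjointD(2)] assms[THEN selfadjointD(3)]
      complex_vec.scale_right_diff_distrib cinner_diff_left cinner_diff_right)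

lemma selfadjoint_ident: "selfadjoint (\<lambda>x::'a::complex_inner. x)"
  by (rule selfadjointI[OF bounded_linear_ident]) simp_all

lemma selfadjoint_eigenvalue_real:
  assumes T: "selfadjoint (T::'a::complex_inner \<Rightarrow> 'a)" and x: "T x = c *\<^sub>C x" "x \<noteq> 0"
  shows "cnj c = c"
  using selfadjointD(3)[OF T, of x x] x by (simp add: cinner_scaleC_left cinner_scaleC_right)

lemma selfadjoint_eigenvectors_orthogonal:
  assumes T: "selfadjoint (T::'a::complex_inner \<Rightarrow> 'a)"
    and x: "T x = c *\<^sub>C x" and y: "T y = d *\<^sub>C y" and "c \<noteq> d"
  shows "cinner x y = 0"
proof (cases "y = 0")
  case False
  \<comment> \<open>For nonzero \<open>y\<close> the eigenvalue \<open>d\<close> is real, so the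
    conjugate produced by the second argument disappears.\<close>
  then have "c * cinner x y = d * cinner x y"
    using selfadjointD(3)[OF T, of x y] selfadjoint_eigenvalue_real[OF T y]
    by (simp add: x y cinner_scaleC_left cinner_scaleC_right)
  then show ?thesis
    using \<open>c \<noteq> d\<close> by simp
qed simp

lemma subspace_ceigenspace:
  assumes "selfadjoint (T::'a::complex_inner \<Rightarrow> 'a)"
  shows "complex_vec.subspace (ceigenspace T c)"
  by (simp add: complex_vec.subspace_def ceigenspace_def selfadjointD[OF assms] scaleC_add_right
      scaleC_scaleC mult.commute)

lemma closed_ceigenspace:
  assumes "selfadjoint (T::'a::complex_inner \<Rightarrow> 'a)"
  shows "closed (ceigenspace T c)"
  unfolding ceigenspace_def
  by (intro closed_Collect_eq linear_continuous_on selfadjointD(1)[OF assms] bounded_linear_scaleC)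

text \<open>Totality of the eigenvectors can be carried from one operator to another by an inclusion
  of spans. Conversely it gives a basis: bases of the single eigenspaces unite to an orthonormal
  set, because different eigenspaces are orthogonal.\<close>

lemma diagonalizable_iff_total_eigenvectors:
  assumes T: "selfadjoint (T::'a::chilbert_space \<Rightarrow> 'a)"
  shows "diagonalizable_op T \<longleftrightarrow> closure (complex_vec.span (\<Union>c. ceigenspace T c)) = UNIV"
    (is "_ \<longleftrightarrow> closure (complex_vec.span ?V) = UNIV")
proof
  assume "diagonalizable_op T"
  then obtain E where E: "closure (complex_vec.span E) = UNIV" "\<And>e. e \<in> E \<Longrightarrow> \<exists>c. is_ceigenvector T c e"
    by (auto simp: diagonalizable_op_def orthonormal_basis_of_def)
  then have "E \<subseteq> ?V"
    by (auto simp: is_ceigenvector_def)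
  then show "closure (complex_vec.span ?V) = UNIV"
    using E(1) closure_mono[OF complex_vec.span_mono] by blast
next
  assume total: "closure (complex_vec.span ?V) = UNIV"
  \<comment> \<open>The choice runs over all complex \<open>c\<close>; where \<open>c\<close> is no
    eigenvalue, the eigenspace is zero and \<open>B c\<close> is empty.\<close>
  obtain B where B: "\<And>c. orthonormal_basis_of (ceigenspace T c) (B c)"
    using orthonormal_basis_exists[OF subspace_ceigenspace[OF T] closed_ceigenspace[OF T]] by metis
  define E where "E = (\<Union>c. B c)"
  have B_eigen: "x \<in> ceigenspace T c" if "x \<in> B c" for x c
    using B[of c] subset_closure_span that by (auto simp: orthonormal_basis_of_def)
  have B_on: "orthonormal_set (B c)" for c
    using B by (simp add: orthonormal_basis_of_def)
  have "cinner x y = (if x = y then 1 else 0)" if "x \<in> B c" "y \<in> B d" for x y c d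
  proof (cases "c = d")
    case True
    then show ?thesis
      using that B_on[of c] by (auto simp: orthonormal_set_def)
  next
    case False
    then have "cinner x y = 0"
      using selfadjoint_eigenvectors_orthogonal[OF T] B_eigen that
      unfolding ceigenspace_def by blast
    then show ?thesis
      using orthonormal_setD(3)[OF B_on that(1)] by auto
  qed
  then have "orthonormal_set E"
    by (auto simp: orthonormal_set_def E_def)
  moreover have "ceigenspace T c \<subseteq> closure (complex_vec.span E)" for c
    using B[of c] closure_mono[OF complex_vec.span_mono[of "B c" E]]
    by (auto simp: orthonormal_basis_of_def E_def)
  then have "closure (complex_vec.span E) = UNIV"
    using closure_span_minimal[of ?V "closure (complex_vec.span E)"] total
      subspace_closure[OF complex_vec.subspace_span] by blast
  moreover have "\<exists>c. is_ceigenvector T c e" if "e \<in> E" for e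
    using that B_eigen orthonormal_setD(1)[OF B_on]
    unfolding E_def is_ceigenvector_def by fastforce
  ultimately show "diagonalizable_op T"
    by (auto simp: diagonalizable_op_def orthonormal_basis_of_def)
qed

section \<open>Hilbert dimension under isometries\<close>

text \<open>The image under \<open>U\<close> of the basis chosen for \<open>M\<close> is an
  orthonormal set in \<open>N\<close> of the same cardinality, and
  \<open>card_of_orthonormal_le\<close> compares it with the basis chosen for
  \<open>N\<close>.\<close>

lemma hilbert_dim_le_of_isometry:
  fixes M N :: "'a::chilbert_space set"
  assumes M: "complex_vec.subspace M" "closed M" and N: "complex_vec.subspace N" "closed N"
    and U: "\<And>x. x \<in> M \<Longrightarrow> U x \<in> N"
      "\<And>x y. x \<in> M \<Longrightarrow> y \<in> M \<Longrightarrow> cinner (U x) (U y) = cinner x y"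
  shows "hilbert_dim M \<le>o hilbert_dim N"
proof -
  define E F where "E = (SOME E. orthonormal_basis_of M E)" and "F = (SOME F. orthonormal_basis_of N F)"
  have E: "orthonormal_basis_of M E" and F: "orthonormal_basis_of N F"
    unfolding E_def F_def
    by (intro someI_ex[OF orthonormal_basis_exists] M N)+
  have EM: "E \<subseteq> M"
    using E subset_closure_span by (auto simp: orthonormal_basis_of_def)
  have inner: "cinner (U x) (U y) = (if x = y then 1 else 0)" if "x \<in> E" "y \<in> E" for x y
    using U(2)[OF subsetD[OF EM] subsetD[OF EM], OF that] E that by (auto simp: orthonormal_basis_of_def orthonormal_set_def)
  \<comment> \<open>If \<open>U\<close> identified two distinct basis vectors, the same inner
    product would be both 0 and 1.\<close>
  have inj: "inj_on U E"
    by (rule inj_onI) (metis inner zero_neq_one)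
  have "orthonormal_set (U ` E)"
    using inner inj by (auto simp: orthonormal_set_def inj_on_def)
  moreover have "U ` E \<subseteq> closure (complex_vec.span F)"
    using EM U(1) F by (auto simp: orthonormal_basis_of_def)
  ultimately have "|U ` E| \<le>o |F|"
    using F card_of_orthonormal_le by (auto simp: orthonormal_basis_of_def)
  moreover have "|E| \<le>o |U ` E|"
    using inj card_of_ordLeq by blast
  ultimately show ?thesis
    unfolding hilbert_dim_def E_def[symmetric] F_def[symmetric] by (rule ordLeq_transitive[rotated])
qed

section \<open>Anticommuting self-adjoint pairs\<close>

text \<open>The projections are replaced by relations invariant under exchanging \<open>A\<close>
  and \<open>B\<close>, so that \<open>swap\<close> turns every one-sided result into its
  converse.\<close>

locale anticommuting_pair =
  fixes A B :: "'a::chilbert_space \<Rightarrow> 'a"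
  assumes A: "selfadjoint A" and B: "selfadjoint B"
    and anticommute: "A (B x) = - B (A x)"
    and squares: "A (A x) + B (B x) = x"
begin

lemma swap: "anticommuting_pair B A"
  using A B anticommute squares by unfold_locales (simp_all add: add.commute)

lemma B_B_eigen:
  assumes "A x = c *\<^sub>C x"
  shows "B (B x) = (1 - c\<^sup>2) *\<^sub>C x"
proof -
  have "B (B x) = x - A (A x)"
    using squares[of x] by (simp add: eq_diff_eq add.commute)
  then show ?thesis
    by (simp add: assms selfadjointD(2)[OF A] scaleC_scaleC power2_eq_square
        complex_vec.scale_left_diff_distrib)
qed

lemma A_B_eigen:
  assumes "A x = c *\<^sub>C x"
  shows "A (B x) = (- c) *\<^sub>C B x"
  by (simp add: anticommute assms selfadjointD(2)[OF B])

text \<open>On \<open>x\<close> the operator \<open>B\<^sup>2\<close> acts as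
  \<open>m\<^sup>2\<close>, so \<open>(B - m) (B + m) x = 0\<close>.\<close>

lemma B_eigenvector:
  assumes "A x = c *\<^sub>C x" "m\<^sup>2 = 1 - c\<^sup>2"
  shows "B x + m *\<^sub>C x \<in> ceigenspace B m"
proof -
  have "B (B x) = (m * m) *\<^sub>C x"
    using B_B_eigen[OF assms(1)] assms(2) by (simp add: power2_eq_square)
  then show ?thesis
    by (simp add: ceigenspace_def selfadjointD(2,4)[OF B] scaleC_add_right scaleC_scaleC add.commute)
qed

lemma eigenvector_in_span:
  assumes x: "A x = c *\<^sub>C x"
  shows "x \<in> complex_vec.span (\<Union>c. ceigenspace B c)"
proof (cases "1 - c\<^sup>2 = 0")
  case True
  \<comment> \<open>Self-adjointness turns the squared norm of \<open>B x\<close> into the inner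
    product of \<open>x\<close> with \<open>B (B x) = 0\<close>.\<close>
  then have "cinner (B x) (B x) = 0"
    using B_B_eigen[OF x] selfadjointD(3)[OF B, of x "B x"] by simp
  then have "x \<in> ceigenspace B 0"
    by (simp add: ceigenspace_def)
  then show ?thesis
    by (auto intro: complex_vec.span_base)
next
  case False
  \<comment> \<open>A complex root works for every complex \<open>c\<close>, with no need to know
    that \<open>1 - c\<^sup>2\<close> is a nonnegative real.\<close>
  define m where "m = csqrt (1 - c\<^sup>2)"
  have m: "m\<^sup>2 = 1 - c\<^sup>2" "m \<noteq> 0"
    using False by (auto simp: m_def)
  have "B x + m *\<^sub>C x \<in> ceigenspace B m" "B x + (- m) *\<^sub>C x \<in> ceigenspace B (- m)"
    by (intro B_eigenvector[OF x]; simp add: m(1))+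
  then have "(1 / (2 * m)) *\<^sub>C ((B x + m *\<^sub>C x) - (B x + (- m) *\<^sub>C x))
      \<in> complex_vec.span (\<Union>c. ceigenspace B c)"
    by (intro complex_vec.span_scale complex_vec.span_diff) (auto intro!: complex_vec.span_base)
  moreover have "(2 * m) *\<^sub>C x = m *\<^sub>C x + m *\<^sub>C x"
    by (metis mult_2 scaleC_add_left)
  then have "(B x + m *\<^sub>C x) - (B x + (- m) *\<^sub>C x) = (2 * m) *\<^sub>C x"
    by simp
  then have "(1 / (2 * m)) *\<^sub>C ((B x + m *\<^sub>C x) - (B x + (- m) *\<^sub>C x)) = x"
    using m(2) by (simp only: scaleC_scaleC) simp
  ultimately show ?thesis by simp
qed

lemma diagonalizable_transfer: "diagonalizable_op A \<Longrightarrow> diagonalizable_op B"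
proof -
  assume "diagonalizable_op A"
  then have "closure (complex_vec.span (\<Union>c. ceigenspace A c)) = UNIV"
    using diagonalizable_iff_total_eigenvectors[OF A] by simp
  moreover have "(\<Union>c. ceigenspace A c) \<subseteq> complex_vec.span (\<Union>c. ceigenspace B c)"
    using eigenvector_in_span by (auto simp: ceigenspace_def)
  then have "complex_vec.span (\<Union>c. ceigenspace A c) \<subseteq> complex_vec.span (\<Union>c. ceigenspace B c)"
    by (intro complex_vec.span_minimal complex_vec.subspace_span)
  ultimately have "closure (complex_vec.span (\<Union>c. ceigenspace B c)) = UNIV"
    using closure_mono by blast
  then show ?thesis
    using diagonalizable_iff_total_eigenvectors[OF B] by simp
qed

text \<open>On \<open>ker (A - l)\<close> the cross terms of \<open>\<langle>(B + m) x, (B + m) y\<rangle>\<close> vanish, because \<open>B\<close> maps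
  it into the orthogonal space \<open>ker (A + l)\<close>.\<close>

lemma cinner_B_shift:
  fixes l m :: real
  assumes lm: "l\<^sup>2 + m\<^sup>2 = 1" "l \<noteq> 0"
    and x: "A x = complex_of_real l *\<^sub>C x" and y: "A y = complex_of_real l *\<^sub>C y"
  shows "cinner (B x + complex_of_real m *\<^sub>C x) (B y + complex_of_real m *\<^sub>C y)
    = complex_of_real (2 * m\<^sup>2) * cinner x y"
proof -
  have 1: "cinner (B x) y = 0"
    using lm(2) by (intro selfadjoint_eigenvectors_orthogonal[OF A A_B_eigen[OF x] y])
      (simp flip: of_real_minus)
  then have 2: "cinner x (B y) = 0"
    by (simp add: selfadjointD(3)[OF B])
  have "m\<^sup>2 = 1 - l\<^sup>2"
    using lm(1) by simp
  then have "1 - (complex_of_real l)\<^sup>2 = complex_of_real (m\<^sup>2)"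
    by (simp only: of_real_diff of_real_power of_real_1)
  then have "cinner (B x) (B y) = complex_of_real (m\<^sup>2) * cinner x y"
    using B_B_eigen[OF x] selfadjointD(3)[OF B, of "B x" y]
    by (simp add: cinner_scaleC_left)
  then show ?thesis
    using 1 2 by (simp add: cinner_add_left cinner_add_right cinner_scaleC_left cinner_scaleC_right
        power2_eq_square algebra_simps)
qed

lemma eigenspace_isometry:
  fixes l m :: real
  assumes lm: "l\<^sup>2 + m\<^sup>2 = 1" "l \<noteq> 0" "m \<noteq> 0"
  obtains U where "\<And>x. x \<in> ceigenspace A (complex_of_real l) \<Longrightarrow> U x \<in> ceigenspace B (complex_of_real m)"
    "\<And>x y. x \<in> ceigenspace A (complex_of_real l) \<Longrightarrow> y \<in> ceigenspace A (complex_of_real l)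
      \<Longrightarrow> cinner (U x) (U y) = cinner x y"
proof
  \<comment> \<open>The scaling satisfies \<open>k\<^sup>2 * (2 * m\<^sup>2) = 1\<close> and thus
    cancels the factor in \<open>cinner_B_shift\<close>; \<open>m\<close> may have either
    sign.\<close>
  define k where "k = 1 / (sqrt 2 * m)"
  define U where "U x = complex_of_real k *\<^sub>C (B x + complex_of_real m *\<^sub>C x)" for x
  have "m\<^sup>2 = 1 - l\<^sup>2"
    using lm(1) by simp
  then have "(complex_of_real m)\<^sup>2 = 1 - (complex_of_real l)\<^sup>2"
    by (metis of_real_1 of_real_diff of_real_power)
  then show "U x \<in> ceigenspace B (complex_of_real m)" if "x \<in> ceigenspace A (complex_of_real l)" for x
    unfolding U_def using that
    by (intro complex_vec.subspace_scale subspace_ceigenspace B B_eigenvector) (auto simp: ceigenspace_def)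
  have "k * k * (2 * m\<^sup>2) = 1"
    using lm(3) by (simp add: k_def power2_eq_square)
  then have "complex_of_real k * complex_of_real k * complex_of_real (2 * m\<^sup>2) = 1"
    by (metis of_real_1 of_real_mult)
  then show "cinner (U x) (U y) = cinner x y"
    if "x \<in> ceigenspace A (complex_of_real l)" "y \<in> ceigenspace A (complex_of_real l)" for x y
    using cinner_B_shift[OF lm(1,2), of x y] that
    by (simp only: U_def cinner_scaleC_left cinner_scaleC_right ceigenspace_def mem_Collect_eq
        complex_cnj_complex_of_real mult.assoc[symmetric] mult_1)
qed

lemma ceigen_mult_le:
  fixes l m :: real
  assumes "l\<^sup>2 + m\<^sup>2 = 1" "l \<noteq> 0" "m \<noteq> 0"
  shows "ceigen_mult A (complex_of_real l) \<le>o ceigen_mult B (complex_of_real m)"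
  unfolding ceigen_mult_def using eigenspace_isometry[OF assms]
  by (metis hilbert_dim_le_of_isometry subspace_ceigenspace closed_ceigenspace A B)

text \<open>The isometry sends a nonzero eigenvector to a nonzero one, since it preserves
  \<open>cinner x x\<close>.\<close>

lemma is_ceigenvalue_transfer:
  fixes l m :: real
  assumes "l\<^sup>2 + m\<^sup>2 = 1" "l \<noteq> 0" "m \<noteq> 0" "is_ceigenvalue A (complex_of_real l)"
  shows "is_ceigenvalue B (complex_of_real m)"
proof -
  obtain U where U: "\<And>x. x \<in> ceigenspace A (complex_of_real l) \<Longrightarrow> U x \<in> ceigenspace B (complex_of_real m)"
    "\<And>x y. x \<in> ceigenspace A (complex_of_real l) \<Longrightarrow> y \<in> ceigenspace A (complex_of_real l)
      \<Longrightarrow> cinner (U x) (U y) = cinner x y"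
    using eigenspace_isometry[OF assms(1-3)] by metis
  obtain x where "x \<noteq> 0" "x \<in> ceigenspace A (complex_of_real l)"
    using assms(4) by (auto simp: is_ceigenvalue_def is_ceigenvector_def)
  then have "is_ceigenvector B (complex_of_real m) (U x)"
    using U unfolding is_ceigenvector_def by (metis cinner_self_eq_0_iff)
  then show ?thesis
    by (auto simp: is_ceigenvalue_def)
qed

lemma diagonalizable_iff: "diagonalizable_op A \<longleftrightarrow> diagonalizable_op B"
  using diagonalizable_transfer anticommuting_pair.diagonalizable_transfer[OF swap] by blast

text \<open>The conditions on \<open>l\<close> and \<open>m\<close> are symmetric, so
  \<open>swap\<close> with \<open>l\<close> and \<open>m\<close> exchanged supplies the reverse
  inequality.\<close>

lemma ceigen_mult_eq:
  fixes l m :: real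
  assumes "l\<^sup>2 + m\<^sup>2 = 1" "l \<noteq> 0" "m \<noteq> 0"
  shows "ceigen_mult B (complex_of_real m) =o ceigen_mult A (complex_of_real l)"
  using ceigen_mult_le[OF assms] anticommuting_pair.ceigen_mult_le[OF swap, of m l] assms
  by (simp add: ordIso_iff_ordLeq add.commute)

lemma is_ceigenvalue_iff:
  fixes l m :: real
  assumes "l\<^sup>2 + m\<^sup>2 = 1" "l \<noteq> 0" "m \<noteq> 0"
  shows "is_ceigenvalue A (complex_of_real l) \<longleftrightarrow> is_ceigenvalue B (complex_of_real m)"
  using is_ceigenvalue_transfer[OF assms] anticommuting_pair.is_ceigenvalue_transfer[OF swap, of m l] assms
  by (auto simp: add.commute)

end

section \<open>Shift by the identity and return to the projections\<close>

text \<open>Translates statements about \<open>B = P + Q - 1\<close> into statements about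
  \<open>P + Q\<close>: eigenvectors stay, eigenvalues move by one.\<close>

lemma ceigenspace_minus_ident:
  "ceigenspace (\<lambda>x. T x - x) c = ceigenspace T (1 + c :: complex)" for T :: "'a::complex_inner \<Rightarrow> 'a"
  by (auto simp: ceigenspace_def scaleC_add_left diff_eq_eq add.commute)

lemma is_ceigenvector_minus_ident:
  "is_ceigenvector (\<lambda>x. T x - x) c = is_ceigenvector T (1 + c :: complex)" for T :: "'a::complex_inner \<Rightarrow> 'a"
  by (simp add: fun_eq_iff is_ceigenvector_def ceigenspace_minus_ident)

lemma diagonalizable_minus_ident:
  "diagonalizable_op (\<lambda>x. T x - x) = diagonalizable_op T" for T :: "'a::complex_inner \<Rightarrow> 'a"
proof -
  \<comment> \<open>The shift by 1 is a bijection of the complex numbers.\<close>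
  have "(\<exists>c. is_ceigenvector T (1 + c) e) = (\<exists>c. is_ceigenvector T c e)" for e
    by (metis add.commute diff_add_cancel)
  then show ?thesis
    by (simp add: diagonalizable_op_def is_ceigenvector_minus_ident)
qed

text \<open>Idempotence gives \<open>A B = P Q - Q P = - B A\<close> and
  \<open>A\<^sup>2 = P + Q - P Q - Q P = 1 - B\<^sup>2\<close>.\<close>

lemma anticommuting_pair_projections:
  fixes P Q :: "'a::chilbert_space \<Rightarrow> 'a"
  assumes "orthogonal_projection P" "orthogonal_projection Q"
  shows "anticommuting_pair (\<lambda>x. P x - Q x) (\<lambda>x. P x + Q x - x)"
proof
  have P: "selfadjoint P" and Q: "selfadjoint Q"
    using assms by (auto simp: orthogonal_projection_def)
  have PP: "P (P x) = P x" and QQ: "Q (Q x) = Q x" for x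
    using assms by (simp_all add: orthogonal_projection_def fun_eq_iff)
  show "selfadjoint (\<lambda>x. P x - Q x)" "selfadjoint (\<lambda>x. P x + Q x - x)"
    by (intro selfadjoint_diff selfadjoint_add selfadjoint_ident P Q)+
  fix x
  note lin = P[THEN selfadjointD(4)] P[THEN selfadjointD(5)] Q[THEN selfadjointD(4)] Q[THEN selfadjointD(5)]
  show "P (P x + Q x - x) - Q (P x + Q x - x)
      = - (P (P x - Q x) + Q (P x - Q x) - (P x - Q x))"
    by (simp add: lin PP QQ)
  show "P (P x - Q x) - Q (P x - Q x) + (P (P x + Q x - x) + Q (P x + Q x - x) - (P x + Q x - x)) = x"
    by (simp add: lin PP QQ)
qed

theorem corollary2p8:
  fixes P Q :: "'a::chilbert_space \<Rightarrow> 'a"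
  assumes "orthogonal_projection P" and "orthogonal_projection Q"
  shows "(diagonalizable_op (\<lambda>x. P x - Q x) \<longleftrightarrow> diagonalizable_op (\<lambda>x. P x + Q x)) \<and>
    (diagonalizable_op (\<lambda>x. P x - Q x) \<longrightarrow>
      (\<forall>l::real. 0 < \<bar>l\<bar> \<and> \<bar>l\<bar> < 1 \<longrightarrow>
        (is_ceigenvalue (\<lambda>x. P x - Q x) (complex_of_real l) \<longleftrightarrow>
          is_ceigenvalue (\<lambda>x. P x + Q x) (complex_of_real (1 + sqrt (1 - l\<^sup>2))) \<and>
          is_ceigenvalue (\<lambda>x. P x + Q x) (complex_of_real (1 - sqrt (1 - l\<^sup>2)))) \<and>
        ceigen_mult (\<lambda>x. P x + Q x) (complex_of_real (1 + sqrt (1 - l\<^sup>2)))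
          =o ceigen_mult (\<lambda>x. P x - Q x) (complex_of_real l) \<and>
        ceigen_mult (\<lambda>x. P x + Q x) (complex_of_real (1 - sqrt (1 - l\<^sup>2)))
          =o ceigen_mult (\<lambda>x. P x - Q x) (complex_of_real l)))"
proof (intro conjI impI allI)
  interpret anticommuting_pair "\<lambda>x. P x - Q x" "\<lambda>x. P x + Q x - x"
    using assms by (rule anticommuting_pair_projections)
  show "diagonalizable_op (\<lambda>x. P x - Q x) \<longleftrightarrow> diagonalizable_op (\<lambda>x. P x + Q x)"
    using diagonalizable_iff by (simp add: diagonalizable_minus_ident)
  fix l :: real assume "0 < \<bar>l\<bar> \<and> \<bar>l\<bar> < 1"
  then have l: "l \<noteq> 0" "l\<^sup>2 < 1"
    by (auto simp: abs_square_less_1)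
  define m where "m = sqrt (1 - l\<^sup>2)"
  \<comment> \<open>Both \<open>m\<close> and \<open>- m\<close> are admissible partners of
    \<open>l\<close>; after the shift by 1 they become the two eigenvalues \<open>1 + m\<close> and
    \<open>1 - m\<close> of \<open>P + Q\<close>.\<close>
  have m: "l\<^sup>2 + m\<^sup>2 = 1" "m \<noteq> 0" and m': "l\<^sup>2 + (- m)\<^sup>2 = 1" "- m \<noteq> 0"
    using l by (auto simp: m_def)
  have eigenvalue: "is_ceigenvalue (\<lambda>x. P x + Q x - x) c \<longleftrightarrow> is_ceigenvalue (\<lambda>x. P x + Q x) (1 + c)" for c
    by (simp add: is_ceigenvalue_def is_ceigenvector_minus_ident)
  have mult: "ceigen_mult (\<lambda>x. P x + Q x - x) c = ceigen_mult (\<lambda>x. P x + Q x) (1 + c)" for c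
    by (simp add: ceigen_mult_def ceigenspace_minus_ident)
  \<comment> \<open>Each of the two conjuncts is by itself equivalent to the left-hand side.\<close>
  show "is_ceigenvalue (\<lambda>x. P x - Q x) (complex_of_real l) \<longleftrightarrow>
      is_ceigenvalue (\<lambda>x. P x + Q x) (complex_of_real (1 + sqrt (1 - l\<^sup>2))) \<and>
      is_ceigenvalue (\<lambda>x. P x + Q x) (complex_of_real (1 - sqrt (1 - l\<^sup>2)))"
    using is_ceigenvalue_iff[OF m(1) l(1) m(2)] is_ceigenvalue_iff[OF m'(1) l(1) m'(2)]
    by (simp add: eigenvalue m_def)
  show "ceigen_mult (\<lambda>x. P x + Q x) (complex_of_real (1 + sqrt (1 - l\<^sup>2)))
      =o ceigen_mult (\<lambda>x. P x - Q x) (complex_of_real l)"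
    using ceigen_mult_eq[OF m(1) l(1) m(2)] by (simp add: mult m_def)
  show "ceigen_mult (\<lambda>x. P x + Q x) (complex_of_real (1 - sqrt (1 - l\<^sup>2)))
      =o ceigen_mult (\<lambda>x. P x - Q x) (complex_of_real l)"
    using ceigen_mult_eq[OF m'(1) l(1) m'(2)] by (simp add: mult m_def)
qed

end
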